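(* Let $\Psi=(\psi_n)_{n=1}^\infty$ and $\Phi=(\phi_n)_{n=1}^\infty$ be Bessel sequences in separable Hilbert spaces $\mathcal{H}_1$ and $\mathcal{H}_2$, respectively, and let $m=(m_n)_{n=1}^\infty\subseteq\mathbb{C}$ be bounded. Assume that the multiplier $M:=M_{m,\Phi,\Psi}:\mathcal{H}_1\to\mathcal{H}_2$ has closed range, and let $W\subseteq\mathcal{H}_1$, $V\subseteq\mathcal{H}_2$ be closed subspaces with $\mathcal{H}_1=W\oplus\ker(M)$ and $\mathcal{H}_2=\operatorname{ran}(M)\oplus V$. Let $M^{\#}_{W,V}:\mathcal{H}_2\to\mathcal{H}_1$ be the oblique pseudoinverse of $M$ on $W$ along $V$. Then the following statements are true. (i) $\Psi^{\#}_{W,V}:=(M^{\#}_{W,V}(m_n\phi_n))_{n=1}^\infty$ is a frame for $W$. (ii) $\Phi^{\#}_{W,V}:=((M^{\#}_{W,V})^*(\overline{m_n}\psi_n))_{n=1}^\infty$ is a frame for $V^\perp$.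
   Context: Here $X\oplus Y$ denotes a direct sum, not necessarily orthogonal. A sequence $(x_n)$ in a closed subspace $X$ of a Hilbert space is a Bessel sequence in $X$ if there is $B>0$ with $\sum_n|\langle h,x_n\rangle|^2\le B\|h\|^2$ for all $h\in X$, and a frame for $X$ if moreover $A\|h\|^2\le\sum_n|\langle h,x_n\rangle|^2$ for some $A>0$ and all $h\in X$. For sequences $\Psi$ in $\mathcal{H}_1$, $\Phi$ in $\mathcal{H}_2$ and scalars $m$, the multiplier is $M_{m,\Phi,\Psi}h=\sum_n m_n\langle h,\psi_n\rangle\phi_n$. For Bessel sequences and bounded $m$ it is a bounded operator $\mathcal{H}_1\to\mathcal{H}_2$. Oblique pseudoinverse: for a bounded operator $M:\mathcal{H}_1\to\mathcal{H}_2$ with closed range and closed subspaces $W,V$ with $\mathcal{H}_1=W\oplus\ker(M)$, $\mathcal{H}_2=\operatorname{ran}(M)\oplus V$, each $y\in\mathcal{H}_2$ can be written as $y=Mx_y+z_y$ with unique $x_y\in W$, $z_y\in V$; the oblique pseudoinverse of $M$ on $W$ along $V$ is $M^{\#}_{W,V}y:=x_y$. It is a bounded linear operator $\mathcal{H}_2\to\mathcal{H}_1$. *)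

theory Defs
  imports "HOL-Analysis.Analysis" "HOL-Library.Set_Algebras"
begin

text \<open>
  Complex Hilbert spaces. The distribution only has real inner product spaces. The real scalar
  multiplication underlying \<^class>\<open>real_normed_vector\<close> is the restriction of the complex one, and
  the inner product is linear in its first argument and conjugate-linear in its second.
\<close>

class complex_inner = real_normed_vector +
  fixes scaleC :: "complex \<Rightarrow> 'a \<Rightarrow> 'a"  (infixr "*\<^sub>C" 75)
    and cinner :: "'a \<Rightarrow> 'a \<Rightarrow> complex"
  assumes scaleC_add_right: "a *\<^sub>C (x + y) = a *\<^sub>C x + a *\<^sub>C y"
    and scaleC_add_left: "(a + b) *\<^sub>C x = a *\<^sub>C x + b *\<^sub>C x"
    and scaleC_scaleC: "a *\<^sub>C (b *\<^sub>C x) = (a * b) *\<^sub>C x"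
    and scaleC_one: "1 *\<^sub>C x = x"
    and scaleR_scaleC: "r *\<^sub>R x = complex_of_real r *\<^sub>C x"
    and cinner_commute: "cinner x y = cnj (cinner y x)"
    and cinner_add_left: "cinner (x + y) z = cinner x z + cinner y z"
    and cinner_scaleC_left: "cinner (a *\<^sub>C x) y = a * cinner x y"
    and cinner_ge_zero: "0 \<le> Re (cinner x x)"
    and cinner_eq_zero_iff: "cinner x x = 0 \<longleftrightarrow> x = 0"
    and norm_eq_sqrt_cinner: "norm x = sqrt (Re (cinner x x))"

class complex_hilbert = complex_inner + complete_space

instantiation complex :: complex_hilbert
begin

definition scaleC_complex :: "complex \<Rightarrow> complex \<Rightarrow> complex" where
  "scaleC_complex a x = a * x"

definition cinner_complex :: "complex \<Rightarrow> complex \<Rightarrow> complex" where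
  "cinner_complex x y = x * cnj y"

instance
  by standard
    (auto simp: scaleC_complex_def cinner_complex_def algebra_simps scaleR_conv_of_real
      norm_complex_def power2_eq_square)

end

global_interpretation complex_vector: vector_space "scaleC :: complex \<Rightarrow> 'a \<Rightarrow> 'a::complex_inner"
  defines csubspace = complex_vector.subspace
  by unfold_locales (simp_all add: scaleC_add_right scaleC_add_left scaleC_scaleC scaleC_one)

definition closed_csubspace :: "'a::complex_inner set \<Rightarrow> bool" where
  "closed_csubspace X \<longleftrightarrow> csubspace X \<and> closed X"

definition orth_compl :: "'a::complex_inner set \<Rightarrow> 'a set" where
  "orth_compl V = {x. \<forall>v\<in>V. cinner x v = 0}"

text \<open>The whole space is the (not necessarily orthogonal) direct sum of two subspaces.\<close>

definition direct_sum_UNIV :: "'a::complex_inner set \<Rightarrow> 'a set \<Rightarrow> bool" where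
  "direct_sum_UNIV X Y \<longleftrightarrow> X + Y = UNIV \<and> X \<inter> Y = {0}"

text \<open>The adjoint is meaningful for bounded complex-linear operators between Hilbert spaces, for
  which it exists and is unique.\<close>

definition cadjoint :: "('a::complex_inner \<Rightarrow> 'b::complex_inner) \<Rightarrow> 'b \<Rightarrow> 'a" where
  "cadjoint T = (THE S. \<forall>x y. cinner (T x) y = cinner x (S y))"

text \<open>Summability is required explicitly because \<^const>\<open>suminf\<close> has an unspecified value on
  divergent series.\<close>

definition bessel_sequence_in :: "'a::complex_inner set \<Rightarrow> (nat \<Rightarrow> 'a) \<Rightarrow> bool" where
  "bessel_sequence_in X x \<longleftrightarrow>
     closed_csubspace X \<and> range x \<subseteq> X \<and>
     (\<exists>B>0. \<forall>h\<in>X. summable (\<lambda>n. (cmod (cinner h (x n)))\<^sup>2) \<and>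
                    (\<Sum>n. (cmod (cinner h (x n)))\<^sup>2) \<le> B * (norm h)\<^sup>2)"

definition frame_for :: "'a::complex_inner set \<Rightarrow> (nat \<Rightarrow> 'a) \<Rightarrow> bool" where
  "frame_for X x \<longleftrightarrow>
     bessel_sequence_in X x \<and>
     (\<exists>A>0. \<forall>h\<in>X. A * (norm h)\<^sup>2 \<le> (\<Sum>n. (cmod (cinner h (x n)))\<^sup>2))"

definition multiplier ::
  "(nat \<Rightarrow> complex) \<Rightarrow> (nat \<Rightarrow> 'b::complex_inner) \<Rightarrow> (nat \<Rightarrow> 'a::complex_inner) \<Rightarrow> 'a \<Rightarrow> 'b" where
  "multiplier m \<Phi> \<Psi> h = (\<Sum>n. (m n * cinner h (\<Psi> n)) *\<^sub>C \<Phi> n)"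

text \<open>The component in \<open>W\<close> is unique when the domain is the direct sum of \<open>W\<close> and the kernel of \<open>M\<close>
  and the codomain is the direct sum of the range of \<open>M\<close> and \<open>V\<close>.\<close>

definition oblique_pinv ::
  "('a::complex_inner \<Rightarrow> 'b::complex_inner) \<Rightarrow> 'a set \<Rightarrow> 'b set \<Rightarrow> 'b \<Rightarrow> 'a" where
  "oblique_pinv M W V y = (THE x. x \<in> W \<and> (\<exists>z\<in>V. y = M x + z))"

end

theory Submission
  imports Defs
begin

text \<open>
  The operator \<open>N\<close> = \<^term>\<open>oblique_pinv M W V\<close> is everywhere defined and its graph is closed, because
  \<open>M\<close> is continuous and \<open>W\<close> and \<open>V\<close> are closed; hence it is bounded and has an adjoint. The Bessel
  bounds of the two new sequences follow by moving \<open>N\<close> to the other side of the inner product. For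
  the lower bounds, \<open>N (M h) = h\<close> on \<open>W\<close> gives
  \<open>(norm h)\<^sup>2 = (\<Sum>n. cinner h (\<Psi> n) * cinner (N (m n *\<^sub>C \<Phi> n)) h)\<close>, and \<open>h - M (N h) \<in> V\<close> gives for \<open>h\<close>
  orthogonal to \<open>V\<close> the analogous expansion with coefficients \<open>cinner h (\<Phi> n)\<close>. Since the coefficients
  have square sum at most \<open>B * (norm h)\<^sup>2\<close>, Cauchy-Schwarz yields the lower frame bound \<open>1 / B\<close>.
\<close>

section \<open>Complex inner products, the Riesz representation theorem and adjoints\<close>

lemma cinner_add_right: "cinner x (y + z) = cinner x y + cinner x z"
  by (metis cinner_add_left cinner_commute complex_cnj_add)

lemma cinner_scaleC_right: "cinner x (a *\<^sub>C y) = cnj a * cinner x y"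
  by (metis cinner_scaleC_left cinner_commute complex_cnj_mult)

lemma cinner_scaleR_left: "cinner (r *\<^sub>R x) y = r * cinner x y"
  by (simp add: scaleR_scaleC cinner_scaleC_left)

lemma cinner_zero_left [simp]: "cinner 0 y = 0"
  using cinner_scaleR_left[of 0 0 y] by simp

lemma cinner_zero_right [simp]: "cinner x 0 = 0"
  by (metis cinner_commute cinner_zero_left complex_cnj_zero)

lemma cinner_minus_left: "cinner (- x) y = - cinner x y"
  using cinner_scaleR_left[of "-1" x y] by simp

lemma cinner_diff_left: "cinner (x - y) z = cinner x z - cinner y z"
  using cinner_add_left[of x "- y" z] by (simp add: cinner_minus_left)

lemma cinner_diff_right: "cinner x (y - z) = cinner x y - cinner x z"
  by (metis cinner_diff_left cinner_commute complex_cnj_diff)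

lemma cinner_self: "cinner x x = complex_of_real ((norm x)\<^sup>2)"
proof -
  have "Im (cinner x x) = 0"
    using arg_cong[OF cinner_commute[of x x], of Im] by simp
  moreover have "Re (cinner x x) = (norm x)\<^sup>2"
    using cinner_ge_zero[of x] by (simp add: norm_eq_sqrt_cinner)
  ultimately show ?thesis
    by (simp add: complex_eq_iff)
qed

lemma cmod_cinner_commute: "cmod (cinner x y) = cmod (cinner y x)"
  by (metis cinner_commute complex_mod_cnj)

lemma norm_add_sq: "(norm (x + y))\<^sup>2 = (norm x)\<^sup>2 + (norm y)\<^sup>2 + 2 * Re (cinner x y)"
proof -
  have "complex_of_real ((norm (x + y))\<^sup>2) = cinner x x + cinner y y + (cinner x y + cnj (cinner x y))"
    unfolding cinner_self[symmetric]
    using cinner_commute[of y x] by (simp add: cinner_add_left cinner_add_right)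
  then have "Re (complex_of_real ((norm (x + y))\<^sup>2))
      = Re (cinner x x + cinner y y + (cinner x y + cnj (cinner x y)))"
    by (rule arg_cong)
  then show ?thesis
    by (simp add: cinner_self)
qed

lemma norm_diff_sq: "(norm (x - y))\<^sup>2 = (norm x)\<^sup>2 + (norm y)\<^sup>2 - 2 * Re (cinner x y)"
  using norm_add_sq[of x "-y"] cinner_diff_right[of x 0 y] by simp

lemma parallelogram_law:
  fixes x y :: "'a::complex_inner"
  shows "(norm (x + y))\<^sup>2 + (norm (x - y))\<^sup>2 = 2 * (norm x)\<^sup>2 + 2 * (norm y)\<^sup>2"
  by (simp add: norm_add_sq norm_diff_sq)

lemma norm_scaleC: "norm (a *\<^sub>C x) = cmod a * norm x"
proof -
  have "complex_of_real ((norm (a *\<^sub>C x))\<^sup>2) = (a * cnj a) * cinner x x"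
    unfolding cinner_self[symmetric] by (simp add: cinner_scaleC_left cinner_scaleC_right)
  also have "\<dots> = complex_of_real ((cmod a * norm x)\<^sup>2)"
    by (simp add: complex_mult_cnj cinner_self power_mult_distrib cmod_power2)
  finally show ?thesis
    by (simp only: of_real_eq_iff power2_eq_iff_nonneg norm_ge_zero mult_nonneg_nonneg)
qed

text \<open>Both vectors are normalised to \<open>u\<close> and \<open>v\<close>; expanding
  \<open>0 \<le> (norm (u - v))\<^sup>2\<close> for unit vectors leaves exactly
  \<open>Re (cinner u v) \<le> 1\<close>.\<close>

lemma Re_cinner_le: "Re (cinner x y) \<le> norm x * norm y"
proof (cases "x = 0 \<or> y = 0")
  case False
  define u where "u = (1 / norm x) *\<^sub>R x"
  define v where "v = (1 / norm y) *\<^sub>R y"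
  have n: "norm u = 1" "norm v = 1"
    using False by (auto simp: u_def v_def)
  have "cinner u v = complex_of_real (1 / norm x) * complex_of_real (1 / norm y) * cinner x y"
    by (simp add: u_def v_def scaleR_scaleC cinner_scaleC_left cinner_scaleC_right)
  then have "Re (cinner u v) = (1 / norm x) * (1 / norm y) * Re (cinner x y)"
    by (metis Re_complex_of_real complex_scaleR of_real_mult scaleR_complex.simps(1) scaleR_conv_of_real)
  moreover have "0 \<le> (norm (u - v))\<^sup>2"
    by simp
  then have "Re (cinner u v) \<le> 1"
    by (simp add: norm_diff_sq n)
  ultimately have "Re (cinner x y) / (norm x * norm y) \<le> 1"
    by simp
  then show ?thesis
    using False by (simp add: pos_divide_le_eq)
qed auto

text \<open>Multiplying \<open>x\<close> by the unimodular conjugate phase of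
  \<open>cinner x y\<close> makes the inner product real and nonnegative without changing
  \<open>norm x\<close>, so the bound on real parts suffices.\<close>

lemma cinner_Cauchy_Schwarz: "cmod (cinner x y) \<le> norm x * norm y"
proof (cases "cinner x y = 0")
  case False
  define a where "a = cnj (sgn (cinner x y))"
  have "cinner (a *\<^sub>C x) y = cmod (cinner x y)"
    using False by (simp add: a_def cinner_scaleC_left sgn_eq complex_norm_square[symmetric] power2_eq_square divide_simps)
      (simp add: complex_norm_square[symmetric] power2_eq_square mult.commute)
  then have "cmod (cinner x y) = Re (cinner (a *\<^sub>C x) y)"
    by simp
  also have "\<dots> \<le> norm (a *\<^sub>C x) * norm y"
    by (rule Re_cinner_le)
  also have "norm (a *\<^sub>C x) = norm x"
    using False by (simp add: norm_scaleC a_def norm_sgn)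
  finally show ?thesis .
qed auto

section \<open>Bounded complex-linear maps and the Riesz representation\<close>

lemma bounded_linear_cinner_left: "bounded_linear (\<lambda>x. cinner x y)"
  by (rule bounded_linear_intro[where K = "norm y"])
     (simp_all add: cinner_add_left cinner_scaleR_left cinner_Cauchy_Schwarz scaleR_conv_of_real)

lemma bounded_linear_scaleC_right: "bounded_linear (\<lambda>x. a *\<^sub>C x)"
  by (rule bounded_linear_intro[where K = "cmod a"])
     (simp_all add: scaleC_add_right scaleR_scaleC scaleC_scaleC norm_scaleC mult.commute)

text \<open>\<open>bounded_linear\<close> is a real-linear notion; continuity and termwise
  application to series come from it, and only compatibility with complex scalars is added.\<close>

definition bounded_clinear :: "('a::complex_inner \<Rightarrow> 'b::complex_inner) \<Rightarrow> bool" where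
  "bounded_clinear T \<longleftrightarrow> bounded_linear T \<and> (\<forall>a x. T (a *\<^sub>C x) = a *\<^sub>C T x)"

instance complex_hilbert \<subseteq> banach ..

text \<open>The representing vector minimises \<open>(norm x)\<^sup>2 - 2 * Re (f x)\<close>.\<close>

lemma riesz_representation:
  fixes f :: "'a::complex_hilbert \<Rightarrow> complex"
  assumes "bounded_clinear f"
  shows "\<exists>y. \<forall>x. f x = cinner x y"
proof -
  interpret bounded_linear f
    using assms by (simp add: bounded_clinear_def)
  have scale: "f (a *\<^sub>C x) = a * f x" for a x
    using assms by (simp add: bounded_clinear_def scaleC_complex_def)
  obtain K where K: "\<And>x. cmod (f x) \<le> norm x * K"
    using bounded by blast
  define J where "J x = (norm x)\<^sup>2 - 2 * Re (f x)" for x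
  define \<mu> where "\<mu> = Inf (range J)"
  \<comment> \<open>Completing the square: the norm bound on \<open>f\<close> gives
    \<open>J x \<ge> (norm x - K)\<^sup>2 - K\<^sup>2\<close>.\<close>
  have J_ge: "- (K\<^sup>2) \<le> J x" for x
  proof -
    have "Re (f x) \<le> norm x * K"
      using K[of x] complex_Re_le_cmod order_trans by blast
    moreover have "0 \<le> (norm x - K)\<^sup>2"
      by simp
    ultimately show ?thesis
      by (simp add: J_def power2_diff)
  qed
  then have bdd: "bdd_below (range J)"
    by (auto intro!: bdd_belowI)
  have J_mu: "\<mu> \<le> J x" for x
    unfolding \<mu>_def by (rule cInf_lower[OF _ bdd]) simp
  have "\<exists>x. J x < \<mu> + inverse (real (Suc n))" for n
    using cInf_lessD[of "range J" "\<mu> + inverse (real (Suc n))"] by (auto simp: \<mu>_def)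
  then obtain X where X: "\<And>n. J (X n) < \<mu> + inverse (real (Suc n))"
    by metis
  \<comment> \<open>The midpoint of \<open>x\<close> and \<open>y\<close> also has value at least
    \<open>\<mu>\<close>. With the parallelogram law this forces near-minimisers to be close to each
    other, so a minimising sequence is Cauchy.\<close>
  have mid: "(norm (x - y))\<^sup>2 \<le> 2 * ((J x - \<mu>) + (J y - \<mu>))" for x y
  proof -
    have "J ((1/2) *\<^sub>R (x + y)) = (norm (x + y))\<^sup>2 / 4 - Re (f x) - Re (f y)"
      by (simp add: J_def scaleR add power_mult_distrib power2_eq_square add_divide_distrib)
    then show ?thesis
      using J_mu[of "(1/2) *\<^sub>R (x + y)"] parallelogram_law[of x y] by (simp add: J_def field_simps)
  qed
  have "Cauchy X"
  proof (rule metric_CauchyI)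
    fix e :: real assume "0 < e"
    then obtain N where N: "inverse (real (Suc N)) < e\<^sup>2 / 4"
      using reals_Archimedean[of "e\<^sup>2 / 4"] by auto
    have "dist (X i) (X j) < e" if "N \<le> i" "N \<le> j" for i j
    proof -
      have "inverse (real (Suc i)) \<le> inverse (real (Suc N))" "inverse (real (Suc j)) \<le> inverse (real (Suc N))"
        using that by (auto intro!: le_imp_inverse_le)
      then have "J (X i) - \<mu> < e\<^sup>2 / 4" "J (X j) - \<mu> < e\<^sup>2 / 4"
        using X[of i] X[of j] N by linarith+
      then have "(norm (X i - X j))\<^sup>2 < e\<^sup>2"
        using mid[of "X i" "X j"] by argo
      then show ?thesis
        using \<open>0 < e\<close> by (simp add: dist_norm power2_less_imp_less)
    qed
    then show "\<exists>N. \<forall>i\<ge>N. \<forall>j\<ge>N. dist (X i) (X j) < e"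
      by blast
  qed
  then obtain y where y: "X \<longlonglongrightarrow> y"
    using Cauchy_convergent convergent_def by blast
  have "(\<lambda>n. J (X n)) \<longlonglongrightarrow> J y"
    unfolding J_def by (intro tendsto_intros y tendsto)
  moreover have "(\<lambda>n. \<mu> + inverse (real (Suc n))) \<longlonglongrightarrow> \<mu>"
    using LIMSEQ_inverse_real_of_nat_add .
  ultimately have "J y \<le> \<mu>"
    by (rule LIMSEQ_le) (use X less_imp_le in blast)
  then have min: "J y \<le> J x" for x
    using J_mu order_trans by blast
  have Re_eq: "Re (f h) = Re (cinner h y)" for h
  proof -
    define d where "d = Re (cinner h y) - Re (f h)"
    \<comment> \<open>This \<open>t\<close> minimises the quadratic
      \<open>2 * t * d + t\<^sup>2 * ((norm h)\<^sup>2 + 1)\<close>. The added 1 keeps the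
      denominator positive when \<open>h = 0\<close>.\<close>
    define t where "t = - d / ((norm h)\<^sup>2 + 1)"
    have pos: "0 < (norm h)\<^sup>2 + 1"
      by (simp add: add_nonneg_pos)
    have "J (y + t *\<^sub>R h) = J y + 2 * t * d + t\<^sup>2 * (norm h)\<^sup>2"
    proof -
      have "Re (cinner y (t *\<^sub>R h)) = t * Re (cinner h y)"
        using cinner_commute[of y h] by (simp add: scaleR_scaleC cinner_scaleC_right)
      moreover have "Re (f (y + t *\<^sub>R h)) = Re (f y) + t * Re (f h)"
        by (simp add: add scaleR)
      moreover have "(norm (t *\<^sub>R h))\<^sup>2 = t\<^sup>2 * (norm h)\<^sup>2"
        by (simp add: power_mult_distrib)
      ultimately show ?thesis
        by (simp add: J_def d_def norm_add_sq algebra_simps)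
    qed
    then have "0 \<le> 2 * t * d + t\<^sup>2 * (norm h)\<^sup>2"
      using min[of "y + t *\<^sub>R h"] by simp
    also have "\<dots> \<le> 2 * t * d + t\<^sup>2 * ((norm h)\<^sup>2 + 1)"
      by (simp add: distrib_left)
    also have "\<dots> = - (d\<^sup>2 / ((norm h)\<^sup>2 + 1))"
      using pos by (simp add: t_def power2_eq_square)
    finally have "d\<^sup>2 \<le> 0"
      using pos by (simp add: divide_le_0_iff)
    then show ?thesis
      by (simp add: d_def)
  qed
  \<comment> \<open>Equality of real parts at \<open>\<i> *\<^sub>C x\<close> is equality of
    imaginary parts at \<open>x\<close>.\<close>
  have "f x = cinner x y" for x
    using Re_eq[of x] Re_eq[of "\<i> *\<^sub>C x"] by (simp add: complex_eq_iff scale cinner_scaleC_left)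
  then show ?thesis
    by blast
qed

section \<open>Existence, uniqueness and boundedness of adjoints\<close>

lemma cinner_ext: "(\<And>x. cinner x y = cinner x z) \<Longrightarrow> y = z"
  by (metis cinner_diff_right cinner_eq_zero_iff eq_iff_diff_eq_0)

text \<open>This justifies the definite description in \<open>cadjoint\<close>: Riesz representation
  of \<open>\<lambda>x. cinner (T x) y\<close> gives existence, and \<open>cinner_ext\<close> gives
  uniqueness.\<close>

lemma cinner_cadjoint:
  fixes T :: "'a::complex_hilbert \<Rightarrow> 'b::complex_inner"
  assumes "bounded_clinear T"
  shows "cinner (T x) y = cinner x (cadjoint T y)"
proof -
  have "\<exists>z. \<forall>x. cinner (T x) y = cinner x z" for y
    using assms
    by (intro riesz_representation)
       (auto simp: bounded_clinear_def scaleC_complex_def cinner_scaleC_left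
          intro: bounded_linear_compose[OF bounded_linear_cinner_left])
  then obtain S where S: "\<forall>x y. cinner (T x) y = cinner x (S y)"
    by metis
  have "cadjoint T = S"
    unfolding cadjoint_def
  proof (rule the_equality)
    show "\<forall>x y. cinner (T x) y = cinner x (S y)"
      by (rule S)
  next
    fix S' assume "\<forall>x y. cinner (T x) y = cinner x (S' y)"
    then have "cinner x (S' y) = cinner x (S y)" for x y
      using S by metis
    then show "S' = S"
      by (metis cinner_ext ext)
  qed
  then show ?thesis
    using S by simp
qed

lemma bounded_linear_cadjoint:
  fixes T :: "'a::complex_hilbert \<Rightarrow> 'b::complex_inner"
  assumes T: "bounded_clinear T"
  shows "bounded_linear (cadjoint T)"
proof -
  obtain K where "0 \<le> K" and K: "\<And>x. norm (T x) \<le> norm x * K"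
    using T bounded_linear.nonneg_bounded unfolding bounded_clinear_def by blast
  note adj = cinner_cadjoint[OF T, symmetric]
  show ?thesis
  proof (rule bounded_linear_intro[where K = K])
    fix x y show "cadjoint T (x + y) = cadjoint T x + cadjoint T y"
      by (rule cinner_ext) (simp add: adj cinner_add_right)
  next
    fix r x show "cadjoint T (r *\<^sub>R x) = r *\<^sub>R cadjoint T x"
      by (rule cinner_ext) (simp add: adj scaleR_scaleC cinner_scaleC_right)
  next
    fix x
    \<comment> \<open>The square of the norm is rewritten as a pairing of
      \<open>T (cadjoint T x)\<close> with \<open>x\<close>, so that the bound on \<open>T\<close>
      applies and one factor \<open>norm (cadjoint T x)\<close> cancels.\<close>
    have "norm (cadjoint T x) * norm (cadjoint T x) = cmod (cinner (cadjoint T x) (cadjoint T x))"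
      by (simp add: cinner_self power2_eq_square norm_mult)
    also have "\<dots> = cmod (cinner (T (cadjoint T x)) x)"
      by (simp add: adj)
    also have "\<dots> \<le> norm (T (cadjoint T x)) * norm x"
      by (rule cinner_Cauchy_Schwarz)
    also have "\<dots> \<le> (norm (cadjoint T x) * K) * norm x"
      by (intro mult_right_mono K) simp
    finally have *: "norm (cadjoint T x) * norm (cadjoint T x) \<le> norm (cadjoint T x) * (norm x * K)"
      by (simp add: mult_ac)
    show "norm (cadjoint T x) \<le> norm x * K"
      using * \<open>0 \<le> K\<close> by (cases "cadjoint T x = 0") simp_all
  qed
qed

section \<open>The closed graph theorem\<close>

text \<open>
  By the Baire category theorem, some ball around the origin lies in the closure of a set on which
  \<open>f\<close> is bounded; successive approximation with halved radii then bounds \<open>f\<close> on the ball itself.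
\<close>

theorem closed_graph:
  fixes f :: "'a::banach \<Rightarrow> 'b::banach"
  assumes "linear f"
    and graph: "\<And>X x y. X \<longlonglongrightarrow> x \<Longrightarrow> (\<lambda>n. f (X n)) \<longlonglongrightarrow> y \<Longrightarrow> f x = y"
  shows "bounded_linear f"
proof -
  interpret linear f
    by fact
  define E where "E k = closure {x. norm (f x) \<le> real k}" for k
  have "(\<Union>k. E k) = UNIV"
  proof -
    have "x \<in> (\<Union>k. E k)" for x
      using real_arch_simple[of "norm (f x)"] closure_subset by (fastforce simp: E_def)
    then show ?thesis
      by blast
  qed
  moreover have "interior (\<Union>k. E k) = {}" if empty: "\<And>k. interior (E k) = {}"
  proof -
    have "closedin euclidean T \<and> euclidean interior_of T = {}" if "T \<in> range E" for T
      using that empty by (auto simp: E_def)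
    then have "euclidean interior_of \<Union> (range E) = {}"
      by (intro Baire_category_alt disjI1 completely_metrizable_space_euclidean countableI_type countable_image)
    then show ?thesis
      by simp
  qed
  ultimately have "\<exists>k. interior (E k) \<noteq> {}"
    by (metis UNIV_not_empty interior_UNIV)
  then obtain k a where "a \<in> interior (E k)"
    by blast
  then obtain r where "0 < r" and r: "ball a r \<subseteq> E k"
    using mem_interior by blast
  \<comment> \<open>The factor 2 arises because a point near the origin is approximated by a
    difference \<open>u - v\<close>, with \<open>u\<close> near \<open>a + x\<close> and
    \<open>v\<close> near \<open>a\<close>, each having image of norm at most
    \<open>k\<close>.\<close>
  define K where "K = 2 * real k"
  have near: "\<exists>u. norm (f u) \<le> K \<and> norm (x - u) < e" if "norm x < r" "0 < e" for x e
  proof -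
    have "a + x \<in> E k" "a \<in> E k"
      using r that \<open>0 < r\<close> by (auto simp: dist_norm)
    then obtain u v where uv: "norm (f u) \<le> k" "norm (f v) \<le> k" "dist u (a + x) < e/2" "dist v a < e/2"
      using \<open>0 < e\<close> unfolding E_def closure_approachable by (metis half_gt_zero mem_Collect_eq)
    have "norm (f (u - v)) \<le> K"
      using uv norm_triangle_ineq4[of "f u" "f v"] by (simp add: diff K_def)
    moreover have "norm (x - (u - v)) < e"
      using uv norm_triangle_ineq4[of "v - a" "u - (a + x)"] by (simp add: dist_norm algebra_simps)
    ultimately show ?thesis
      by blast
  qed
  \<comment> \<open>The approximation \<open>near\<close> is rescaled by \<open>2 ^ n\<close>: the
    remainder \<open>y\<close> lies in the ball of half the radius, and the image of the removed
    part shrinks geometrically.\<close>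
  have step: "\<exists>y. norm y < r / 2 ^ Suc n \<and> norm (f (x - y)) \<le> K * (1/2) ^ n" if "norm x < r / 2 ^ n" for x n
  proof -
    have "norm (2 ^ n *\<^sub>R x) < r"
      using that by (simp add: pos_less_divide_eq mult.commute)
    then obtain u where u: "norm (f u) \<le> K" "norm (2 ^ n *\<^sub>R x - u) < r / 2"
      using near[of "2 ^ n *\<^sub>R x" "r/2"] \<open>0 < r\<close> by auto
    define y where "y = x - (1/2) ^ n *\<^sub>R u"
    have "y = (1/2) ^ n *\<^sub>R (2 ^ n *\<^sub>R x - u)"
      by (simp add: y_def scaleR_diff_right flip: power_mult_distrib)
    then have "norm y < r / 2 ^ Suc n"
      using u by (simp add: power_divide divide_simps mult_ac)
    moreover have "norm (f (x - y)) \<le> K * (1/2) ^ n"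
      using u by (simp add: y_def scale power_divide divide_right_mono)
    ultimately show ?thesis
      by blast
  qed
  have bound: "norm (f x) \<le> 2 * K" if "norm x < r" for x
  proof -
    have "\<exists>R. R 0 = x \<and> (\<forall>n. norm (R n) < r / 2 ^ n \<and> norm (f (R n - R (Suc n))) \<le> K * (1/2) ^ n)"
    proof -
      \<comment> \<open>Iterating \<open>step\<close> yields the remainders \<open>R n\<close>; the
        clause for \<open>n = 0\<close> pins the start of the dependent choice to
        \<open>x\<close>.\<close>
      have "\<exists>R. \<forall>n. (norm (R n) < r / 2 ^ n \<and> (n = 0 \<longrightarrow> R n = x))
          \<and> norm (f (R n - R (Suc n))) \<le> K * (1/2) ^ n"
        by (rule dependent_nat_choice) (use that step in auto)
      then show ?thesis
        by blast
    qed
    then obtain R where R0: "R 0 = x" and Rn: "\<And>n. norm (R n) < r / 2 ^ n"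
      and fR: "\<And>n. norm (f (R n - R (Suc n))) \<le> K * (1/2) ^ n"
      by blast
    have geo: "(\<lambda>n. K * (1/2) ^ n) sums (K * 2)"
      using sums_mult[OF geometric_sums[of "1/2 :: real"], of K] by simp
    have sm: "summable (\<lambda>n. norm (f (R n - R (Suc n))))"
      by (rule summable_comparison_test'[OF sums_summable[OF geo]]) (use fR in simp)
    have "(\<lambda>n. f (R n - R (Suc n))) sums (\<Sum>n. f (R n - R (Suc n)))"
      by (rule summable_sums[OF summable_norm_cancel[OF sm]])
    moreover have "(\<Sum>i<n. f (R i - R (Suc i))) = f (x - R n)" for n
      unfolding sum[symmetric] sum_lessThan_telescope' R0 ..
    ultimately have "(\<lambda>n. f (x - R n)) \<longlonglongrightarrow> (\<Sum>n. f (R n - R (Suc n)))"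
      by (simp add: sums_def)
    moreover have "(\<lambda>n. x - R n) \<longlonglongrightarrow> x - 0"
    proof (intro tendsto_intros)
      show "R \<longlonglongrightarrow> 0"
      proof (rule Lim_null_comparison)
        show "\<forall>\<^sub>F n in sequentially. norm (R n) \<le> r * (1/2) ^ n"
          using Rn by (simp add: power_divide less_imp_le)
        show "(\<lambda>n. r * (1/2) ^ n) \<longlonglongrightarrow> 0"
          by (intro tendsto_mult_right_zero LIMSEQ_realpow_zero) auto
      qed
    qed
    \<comment> \<open>The telescoped images \<open>f (x - R n)\<close> converge while
      \<open>x - R n\<close> tends to \<open>x\<close>, so closedness of the graph identifies the
      limit as \<open>f x\<close>.\<close>
    ultimately have "f x = (\<Sum>n. f (R n - R (Suc n)))"
      using graph[of "\<lambda>n. x - R n" x] by simp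
    also have "norm \<dots> \<le> (\<Sum>n. norm (f (R n - R (Suc n))))"
      by (rule summable_norm[OF sm])
    also have "\<dots> \<le> (\<Sum>n. K * (1/2) ^ n)"
      by (intro suminf_le fR sm sums_summable[OF geo])
    also have "\<dots> = 2 * K"
      using sums_unique[OF geo] by simp
    finally show ?thesis .
  qed
  show ?thesis
  \<comment> \<open>A nonzero \<open>x\<close> is rescaled to norm \<open>r / 2\<close>, inside the
    ball where \<open>2 * K\<close> bounds the image.\<close>
  proof (rule bounded_linear_intro[where K = "4 * K / r"])
    fix x
    show "norm (f x) \<le> norm x * (4 * K / r)"
    proof (cases "x = 0")
      case False
      have "norm ((r / (2 * norm x)) *\<^sub>R x) < r"
        using False \<open>0 < r\<close> by simp
      from bound[OF this] show ?thesis
        using False \<open>0 < r\<close> by (simp add: scale field_simps)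
    qed simp
  qed (simp_all add: add scale)
qed

section \<open>Bessel sequences and multipliers\<close>

text \<open>The finite inequality for absolute values bounds every partial sum, and the bound
  survives the limit. The value \<open>s\<close> is left free so that an expansion of
  \<open>(norm h)\<^sup>2\<close> can be inserted.\<close>

lemma Cauchy_Schwarz_suminf:
  fixes a b :: "nat \<Rightarrow> complex"
  assumes a: "summable (\<lambda>n. (cmod (a n))\<^sup>2)" and b: "summable (\<lambda>n. (cmod (b n))\<^sup>2)"
    and s: "(\<lambda>n. a n * b n) sums s"
  shows "(cmod s)\<^sup>2 \<le> (\<Sum>n. (cmod (a n))\<^sup>2) * (\<Sum>n. (cmod (b n))\<^sup>2)"
proof (rule LIMSEQ_le_const2)
  show "(\<lambda>N. (cmod (\<Sum>n<N. a n * b n))\<^sup>2) \<longlonglongrightarrow> (cmod s)\<^sup>2"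
    using s unfolding sums_def by (intro tendsto_intros)
  have "(cmod (\<Sum>n<N. a n * b n))\<^sup>2 \<le> (\<Sum>n. (cmod (a n))\<^sup>2) * (\<Sum>n. (cmod (b n))\<^sup>2)" for N
  proof -
    have "cmod (\<Sum>n<N. a n * b n) \<le> (\<Sum>n<N. cmod (a n) * cmod (b n))"
      using norm_sum[of "\<lambda>n. a n * b n" "{..<N}"] by (simp add: norm_mult)
    then have "(cmod (\<Sum>n<N. a n * b n))\<^sup>2 \<le> (\<Sum>n<N. cmod (a n) * cmod (b n))\<^sup>2"
      by (simp add: power_mono)
    also have "\<dots> \<le> (\<Sum>n<N. (cmod (a n))\<^sup>2) * (\<Sum>n<N. (cmod (b n))\<^sup>2)"
      by (rule Cauchy_Schwarz_ineq_sum)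
    also have "\<dots> \<le> (\<Sum>n. (cmod (a n))\<^sup>2) * (\<Sum>n. (cmod (b n))\<^sup>2)"
      by (intro mult_mono sum_le_suminf a b suminf_nonneg sum_nonneg) auto
    finally show ?thesis .
  qed
  then show "\<exists>N0. \<forall>N\<ge>N0. (cmod (\<Sum>n<N. a n * b n))\<^sup>2 \<le> (\<Sum>n. (cmod (a n))\<^sup>2) * (\<Sum>n. (cmod (b n))\<^sup>2)"
    by blast
qed

text \<open>Duality with the analysis bound: pairing the sum \<open>S\<close> with itself and
  applying Cauchy-Schwarz gives a bound for the fourth power of \<open>norm S\<close> containing the
  factor \<open>(norm S)\<^sup>2\<close>, which cancels.\<close>

lemma bessel_synthesis_finite:
  fixes \<phi> :: "nat \<Rightarrow> 'a::complex_inner"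
  assumes "finite A" and "0 \<le> B"
    and B: "\<And>h. summable (\<lambda>n. (cmod (cinner h (\<phi> n)))\<^sup>2)"
      "\<And>h. (\<Sum>n. (cmod (cinner h (\<phi> n)))\<^sup>2) \<le> B * (norm h)\<^sup>2"
  shows "(norm (\<Sum>n\<in>A. c n *\<^sub>C \<phi> n))\<^sup>2 \<le> B * (\<Sum>n\<in>A. (cmod (c n))\<^sup>2)"
proof -
  define S where "S = (\<Sum>n\<in>A. c n *\<^sub>C \<phi> n)"
  have "cinner S S = (\<Sum>n\<in>A. cinner (c n *\<^sub>C \<phi> n) S)"
    using bounded_linear.linear[OF bounded_linear_cinner_left[of S], THEN linear_sum, of "\<lambda>n. c n *\<^sub>C \<phi> n" A]
    by (simp add: S_def)
  then have "cinner S S = (\<Sum>n\<in>A. c n * cinner (\<phi> n) S)"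
    by (simp add: cinner_scaleC_left)
  moreover have "(norm S)\<^sup>2 = cmod (cinner S S)"
    by (simp add: cinner_self norm_power)
  ultimately have "(norm S)\<^sup>2 \<le> (\<Sum>n\<in>A. cmod (c n) * cmod (cinner S (\<phi> n)))"
    using norm_sum[of "\<lambda>n. c n * cinner (\<phi> n) S" A]
    by (simp add: norm_mult cmod_cinner_commute[of S])
  then have "((norm S)\<^sup>2)\<^sup>2 \<le> (\<Sum>n\<in>A. cmod (c n) * cmod (cinner S (\<phi> n)))\<^sup>2"
    by (rule power_mono) simp
  also have "\<dots> \<le> (\<Sum>n\<in>A. (cmod (c n))\<^sup>2) * (\<Sum>n\<in>A. (cmod (cinner S (\<phi> n)))\<^sup>2)"
    by (rule Cauchy_Schwarz_ineq_sum)
  also have "\<dots> \<le> (\<Sum>n\<in>A. (cmod (c n))\<^sup>2) * (B * (norm S)\<^sup>2)"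
    using sum_le_suminf[OF B(1) \<open>finite A\<close>, of S] B(2)[of S] by (intro mult_left_mono sum_nonneg) auto
  finally have "(norm S)\<^sup>2 * (norm S)\<^sup>2 \<le> (norm S)\<^sup>2 * (B * (\<Sum>n\<in>A. (cmod (c n))\<^sup>2))"
    by (simp add: power2_eq_square mult_ac)
  moreover have "0 \<le> B * (\<Sum>n\<in>A. (cmod (c n))\<^sup>2)"
    using \<open>0 \<le> B\<close> by (simp add: sum_nonneg)
  ultimately show ?thesis
    unfolding S_def[symmetric]
    by (cases "S = 0") (simp, simp only: mult_le_cancel_left_pos zero_less_power zero_less_norm_iff not_False_eq_True)
qed

text \<open>The finite estimate on blocks \<open>{m..<n}\<close> makes the partial sums Cauchy; on
  initial segments it passes to the limit.\<close>

lemma bessel_synthesis: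
  fixes \<phi> :: "nat \<Rightarrow> 'a::complex_hilbert"
  assumes "0 < B"
    and B: "\<And>h. summable (\<lambda>n. (cmod (cinner h (\<phi> n)))\<^sup>2)"
      "\<And>h. (\<Sum>n. (cmod (cinner h (\<phi> n)))\<^sup>2) \<le> B * (norm h)\<^sup>2"
    and c: "summable (\<lambda>n. (cmod (c n))\<^sup>2)"
  shows "summable (\<lambda>n. c n *\<^sub>C \<phi> n)"
    and "(norm (\<Sum>n. c n *\<^sub>C \<phi> n))\<^sup>2 \<le> B * (\<Sum>n. (cmod (c n))\<^sup>2)"
proof -
  note fin = bessel_synthesis_finite[OF _ less_imp_le[OF \<open>0 < B\<close>] B]
  show sm: "summable (\<lambda>n. c n *\<^sub>C \<phi> n)"
    unfolding summable_Cauchy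
  proof (intro allI impI)
    fix e :: real assume "0 < e"
    then have "0 < e\<^sup>2 / B"
      using \<open>0 < B\<close> by simp
    then obtain N where N: "\<And>m n. N \<le> m \<Longrightarrow> norm (\<Sum>n = m..<n. (cmod (c n))\<^sup>2) < e\<^sup>2 / B"
      using c unfolding summable_Cauchy by blast
    have "norm (\<Sum>n = m..<n. c n *\<^sub>C \<phi> n) < e" if "N \<le> m" for m n
    proof -
      have "(\<Sum>n = m..<n. (cmod (c n))\<^sup>2) < e\<^sup>2 / B"
        using N[OF that, of n] by (simp add: sum_nonneg)
      then have "B * (\<Sum>n = m..<n. (cmod (c n))\<^sup>2) < e\<^sup>2"
        using \<open>0 < B\<close> by (simp add: pos_less_divide_eq mult.commute)
      then have "(norm (\<Sum>n = m..<n. c n *\<^sub>C \<phi> n))\<^sup>2 < e\<^sup>2"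
        using fin[of "{m..<n}" c] by simp
      then show ?thesis
        using \<open>0 < e\<close> by (simp add: power2_less_imp_less)
    qed
    then show "\<exists>N. \<forall>m\<ge>N. \<forall>n. norm (\<Sum>n = m..<n. c n *\<^sub>C \<phi> n) < e"
      by blast
  qed
  show "(norm (\<Sum>n. c n *\<^sub>C \<phi> n))\<^sup>2 \<le> B * (\<Sum>n. (cmod (c n))\<^sup>2)"
  proof (rule LIMSEQ_le_const2)
    show "(\<lambda>N. (norm (\<Sum>n<N. c n *\<^sub>C \<phi> n))\<^sup>2) \<longlonglongrightarrow> (norm (\<Sum>n. c n *\<^sub>C \<phi> n))\<^sup>2"
      by (intro tendsto_intros summable_LIMSEQ sm)
    have "(norm (\<Sum>n<N. c n *\<^sub>C \<phi> n))\<^sup>2 \<le> B * (\<Sum>n. (cmod (c n))\<^sup>2)" for N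
      by (rule order_trans[OF fin mult_left_mono[OF sum_le_suminf[OF c]]]) (use \<open>0 < B\<close> in auto)
    then show "\<exists>N0. \<forall>N\<ge>N0. (norm (\<Sum>n<N. c n *\<^sub>C \<phi> n))\<^sup>2 \<le> B * (\<Sum>n. (cmod (c n))\<^sup>2)"
      by blast
  qed
qed

lemma bessel_sequence_UNIV_obtain:
  assumes "bessel_sequence_in UNIV x"
  obtains B where "0 < B" and "\<And>h. summable (\<lambda>n. (cmod (cinner h (x n)))\<^sup>2)"
    and "\<And>h. (\<Sum>n. (cmod (cinner h (x n)))\<^sup>2) \<le> B * (norm h)\<^sup>2"
proof -
  from assms obtain B where "0 < B"
    and "\<forall>h\<in>UNIV. summable (\<lambda>n. (cmod (cinner h (x n)))\<^sup>2) \<and>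
      (\<Sum>n. (cmod (cinner h (x n)))\<^sup>2) \<le> B * (norm h)\<^sup>2"
    unfolding bessel_sequence_in_def by (elim conjE exE)
  then show thesis
    by (intro that[of B]) simp_all
qed

section \<open>Multipliers of Bessel sequences\<close>

context
  fixes \<Phi> :: "nat \<Rightarrow> 'b::complex_hilbert" and \<Psi> :: "nat \<Rightarrow> 'a::complex_hilbert"
    and m :: "nat \<Rightarrow> complex"
  assumes Psi: "bessel_sequence_in UNIV \<Psi>" and Phi: "bessel_sequence_in UNIV \<Phi>"
    and m: "bounded (range m)"
begin

text \<open>The coefficients \<open>m n * cinner h (\<Psi> n)\<close> are square summable, since
  \<open>m\<close> is bounded and \<open>\<Psi>\<close> is Bessel, and synthesis with
  \<open>\<Phi>\<close> then converges. The convergence gives the \<open>suminf\<close> in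
  \<open>multiplier\<close> its intended value.\<close>

lemma multiplier_bound:
  obtains C where "\<And>h. summable (\<lambda>n. (m n * cinner h (\<Psi> n)) *\<^sub>C \<Phi> n)"
    and "\<And>h. norm (multiplier m \<Phi> \<Psi> h) \<le> norm h * C"
proof -
  obtain K where K: "\<And>n. cmod (m n) \<le> K"
    using m by (auto simp: bounded_iff)
  obtain B1 where B1: "0 < B1" "\<And>h. summable (\<lambda>n. (cmod (cinner h (\<Psi> n)))\<^sup>2)"
      "\<And>h. (\<Sum>n. (cmod (cinner h (\<Psi> n)))\<^sup>2) \<le> B1 * (norm h)\<^sup>2"
    using bessel_sequence_UNIV_obtain[OF Psi] by blast
  obtain B2 where B2: "0 < B2" "\<And>h. summable (\<lambda>n. (cmod (cinner h (\<Phi> n)))\<^sup>2)"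
      "\<And>h. (\<Sum>n. (cmod (cinner h (\<Phi> n)))\<^sup>2) \<le> B2 * (norm h)\<^sup>2"
    using bessel_sequence_UNIV_obtain[OF Phi] by blast
  have le: "(cmod (m n * cinner h (\<Psi> n)))\<^sup>2 \<le> K\<^sup>2 * (cmod (cinner h (\<Psi> n)))\<^sup>2" for h n
    using K[of n] by (simp add: norm_mult power_mult_distrib mult_right_mono power_mono)
  have sm: "summable (\<lambda>n. (cmod (m n * cinner h (\<Psi> n)))\<^sup>2)" for h
    by (rule summable_comparison_test'[OF summable_mult[OF B1(2)[of h], of "K\<^sup>2"]]) (use le in simp)
  show thesis
  proof
    show "summable (\<lambda>n. (m n * cinner h (\<Psi> n)) *\<^sub>C \<Phi> n)" for h
      using bessel_synthesis(1)[OF B2 sm] .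
    show "norm (multiplier m \<Phi> \<Psi> h) \<le> norm h * sqrt (B2 * K\<^sup>2 * B1)" for h
    proof -
      have "(norm (multiplier m \<Phi> \<Psi> h))\<^sup>2 \<le> B2 * (\<Sum>n. (cmod (m n * cinner h (\<Psi> n)))\<^sup>2)"
        unfolding multiplier_def by (rule bessel_synthesis(2)[OF B2 sm])
      also have "\<dots> \<le> B2 * (K\<^sup>2 * (\<Sum>n. (cmod (cinner h (\<Psi> n)))\<^sup>2))"
        using suminf_le[OF le sm summable_mult[OF B1(2)]] B2(1)
        by (simp add: suminf_mult[OF B1(2)])
      also have "\<dots> \<le> B2 * (K\<^sup>2 * (B1 * (norm h)\<^sup>2))"
        using B2(1) B1(3) by (intro mult_left_mono) auto
      finally have "norm (multiplier m \<Phi> \<Psi> h) \<le> sqrt ((norm h)\<^sup>2 * (B2 * K\<^sup>2 * B1))"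
        by (simp add: real_le_rsqrt mult_ac)
      then show ?thesis
        by (simp add: real_sqrt_mult)
    qed
  qed
qed

lemma multiplier_sums: "(\<lambda>n. (m n * cinner h (\<Psi> n)) *\<^sub>C \<Phi> n) sums multiplier m \<Phi> \<Psi> h"
  unfolding multiplier_def using multiplier_bound by (metis summable_sums)

lemma multiplier_scaleC: "multiplier m \<Phi> \<Psi> (a *\<^sub>C h) = a *\<^sub>C multiplier m \<Phi> \<Psi> h"
proof -
  have "(\<lambda>n. (m n * cinner (a *\<^sub>C h) (\<Psi> n)) *\<^sub>C \<Phi> n) sums (a *\<^sub>C multiplier m \<Phi> \<Psi> h)"
    using bounded_linear.sums[OF bounded_linear_scaleC_right multiplier_sums, of a h]
    by (simp add: scaleC_scaleC cinner_scaleC_left mult_ac)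
  then show ?thesis
    using multiplier_sums sums_unique2 by blast
qed

lemma bounded_clinear_multiplier: "bounded_clinear (multiplier m \<Phi> \<Psi>)"
proof -
  have add: "multiplier m \<Phi> \<Psi> (x + y) = multiplier m \<Phi> \<Psi> x + multiplier m \<Phi> \<Psi> y" for x y
  proof -
    have "(\<lambda>n. (m n * cinner (x + y) (\<Psi> n)) *\<^sub>C \<Phi> n) sums (multiplier m \<Phi> \<Psi> x + multiplier m \<Phi> \<Psi> y)"
      using sums_add[OF multiplier_sums[of x] multiplier_sums[of y]]
      by (simp add: cinner_add_left distrib_left scaleC_add_left)
    then show ?thesis
      using multiplier_sums sums_unique2 by blast
  qed
  obtain C where "\<And>h. norm (multiplier m \<Phi> \<Psi> h) \<le> norm h * C"
    using multiplier_bound by metis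
  then have "bounded_linear (multiplier m \<Phi> \<Psi>)"
    by (intro bounded_linear_intro add) (simp_all add: scaleR_scaleC multiplier_scaleC)
  then show ?thesis
    by (simp add: bounded_clinear_def multiplier_scaleC)
qed

end

section \<open>Frames and the oblique pseudoinverse\<close>

text \<open>Shared source of both upper bounds: once an operator is moved across the inner product,
  the new coefficients are dominated by old ones evaluated at \<open>T h\<close>.\<close>

lemma bessel_sequence_in_dominated:
  assumes X: "closed_csubspace X" "range x \<subseteq> X"
    and y: "bessel_sequence_in UNIV y" and T: "bounded_linear T"
    and dom: "\<And>h n. h \<in> X \<Longrightarrow> cmod (cinner h (x n)) \<le> K * cmod (cinner (T h) (y n))"
  shows "bessel_sequence_in X x"
proof -
  obtain B where B: "0 < B" "\<And>h. summable (\<lambda>n. (cmod (cinner h (y n)))\<^sup>2)"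
      "\<And>h. (\<Sum>n. (cmod (cinner h (y n)))\<^sup>2) \<le> B * (norm h)\<^sup>2"
    using bessel_sequence_UNIV_obtain[OF y] by blast
  obtain C where C: "\<And>h. norm (T h) \<le> norm h * C"
    using bounded_linear.bounded[OF T] by blast
  \<comment> \<open>The summand 1 keeps the Bessel constant strictly positive even if
    \<open>K\<close> or \<open>C\<close> is 0.\<close>
  have "summable (\<lambda>n. (cmod (cinner h (x n)))\<^sup>2) \<and>
      (\<Sum>n. (cmod (cinner h (x n)))\<^sup>2) \<le> (K\<^sup>2 * B * C\<^sup>2 + 1) * (norm h)\<^sup>2" if "h \<in> X" for h
  proof -
    have le: "(cmod (cinner h (x n)))\<^sup>2 \<le> K\<^sup>2 * (cmod (cinner (T h) (y n)))\<^sup>2" for n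
      using power_mono[OF dom[OF that], of n 2] by (simp add: power_mult_distrib)
    have sm: "summable (\<lambda>n. (cmod (cinner h (x n)))\<^sup>2)"
      by (rule summable_comparison_test'[OF summable_mult[OF B(2)[of "T h"], of "K\<^sup>2"]]) (use le in simp)
    have "(\<Sum>n. (cmod (cinner h (x n)))\<^sup>2) \<le> K\<^sup>2 * (\<Sum>n. (cmod (cinner (T h) (y n)))\<^sup>2)"
      using suminf_le[OF le sm summable_mult[OF B(2)]] by (simp add: suminf_mult[OF B(2)])
    also have "\<dots> \<le> K\<^sup>2 * (B * (norm h * C)\<^sup>2)"
      using B(1) by (intro mult_left_mono order_trans[OF B(3)] power_mono C) auto
    also have "\<dots> \<le> (K\<^sup>2 * B * C\<^sup>2 + 1) * (norm h)\<^sup>2"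
      by (simp add: power_mult_distrib algebra_simps)
    finally show ?thesis
      using sm by simp
  qed
  moreover have "0 < K\<^sup>2 * B * C\<^sup>2 + 1"
    using B(1) by (intro add_nonneg_pos mult_nonneg_nonneg) auto
  ultimately show ?thesis
    unfolding bessel_sequence_in_def using X by blast
qed

text \<open>Cauchy-Schwarz applied to \<open>dual\<close> bounds the square of
  \<open>(norm h)\<^sup>2\<close> by \<open>B * (norm h)\<^sup>2\<close> times the frame sum;
  cancelling gives the lower bound \<open>1 / B\<close>. The abstract \<open>c\<close> covers
  coefficients against either original sequence.\<close>

lemma frame_for_dual_coefficients:
  fixes c :: "'a::complex_inner \<Rightarrow> nat \<Rightarrow> complex"
  assumes bessel: "bessel_sequence_in X x" and "0 < B"
    and c: "\<And>h. h \<in> X \<Longrightarrow> summable (\<lambda>n. (cmod (c h n))\<^sup>2)"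
      "\<And>h. h \<in> X \<Longrightarrow> (\<Sum>n. (cmod (c h n))\<^sup>2) \<le> B * (norm h)\<^sup>2"
    and dual: "\<And>h. h \<in> X \<Longrightarrow> (\<lambda>n. c h n * cinner (x n) h) sums complex_of_real ((norm h)\<^sup>2)"
  shows "frame_for X x"
proof -
  have "1 / B * (norm h)\<^sup>2 \<le> (\<Sum>n. (cmod (cinner h (x n)))\<^sup>2)" if h: "h \<in> X" for h
  proof -
    have sm: "summable (\<lambda>n. (cmod (cinner (x n) h))\<^sup>2)"
      using bessel h by (auto simp: bessel_sequence_in_def cmod_cinner_commute[of _ h])
    have "(cmod (complex_of_real ((norm h)\<^sup>2)))\<^sup>2
        \<le> (\<Sum>n. (cmod (c h n))\<^sup>2) * (\<Sum>n. (cmod (cinner (x n) h))\<^sup>2)"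
      by (rule Cauchy_Schwarz_suminf[OF c(1)[OF h] sm dual[OF h]])
    also have "\<dots> \<le> (B * (norm h)\<^sup>2) * (\<Sum>n. (cmod (cinner (x n) h))\<^sup>2)"
      by (intro mult_right_mono c(2) h suminf_nonneg sm) simp
    finally have *: "(norm h)\<^sup>2 * (norm h)\<^sup>2 \<le> (norm h)\<^sup>2 * (B * (\<Sum>n. (cmod (cinner (x n) h))\<^sup>2))"
      by (simp add: norm_power norm_mult power2_eq_square mult_ac)
    have "(norm h)\<^sup>2 \<le> B * (\<Sum>n. (cmod (cinner (x n) h))\<^sup>2)"
    proof (cases "h = 0")
      case False
      then have "0 < (norm h)\<^sup>2"
        by simp
      with * show ?thesis
        by (rule mult_left_le_imp_le)
    qed (use \<open>0 < B\<close> in simp)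
    then show ?thesis
      using \<open>0 < B\<close> by (simp add: pos_divide_le_eq mult.commute cmod_cinner_commute[of _ h])
  qed
  moreover have "0 < 1 / B"
    using \<open>0 < B\<close> by simp
  ultimately show ?thesis
    unfolding frame_for_def using bessel by blast
qed

section \<open>Orthogonal complements and the oblique pseudoinverse of a bounded operator\<close>

lemma closed_csubspace_orth_compl: "closed_csubspace (orth_compl V)"
proof -
  have "orth_compl V = (\<Inter>v\<in>V. {x. cinner x v = 0})"
    by (auto simp: orth_compl_def)
  moreover have "closed {x. cinner x v = 0}" for v :: 'a
    by (intro closed_Collect_eq continuous_on_const linear_continuous_on bounded_linear_cinner_left)
  ultimately have "closed (orth_compl V)"
    by auto
  moreover have "csubspace (orth_compl V)"
    by (auto simp: complex_vector.subspace_def orth_compl_def cinner_add_left cinner_scaleC_left)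
  ultimately show ?thesis
    by (simp add: closed_csubspace_def)
qed

text \<open>For two candidates \<open>x\<close> and \<open>x'\<close>, the vector
  \<open>M (x' - x) = z - z'\<close> lies in both \<open>range M\<close> and \<open>V\<close>, hence
  is 0; then \<open>x' - x\<close> lies in both \<open>W\<close> and the kernel, hence is 0.\<close>

lemma oblique_pinv_unique:
  assumes lin: "\<And>x y. M (x - y) = M x - M y"
    and W: "csubspace W" and V: "csubspace V"
    and dW: "W \<inter> {h. M h = 0} = {0}" and dV: "range M \<inter> V = {0}"
    and x: "x \<in> W" and z: "z \<in> V"
  shows "oblique_pinv M W V (M x + z) = x"
  unfolding oblique_pinv_def
proof (rule the_equality)
  show "x \<in> W \<and> (\<exists>z'\<in>V. M x + z = M x + z')"
    using x z by blast
next
  fix x' assume "x' \<in> W \<and> (\<exists>z'\<in>V. M x + z = M x' + z')"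
  then obtain z' where x': "x' \<in> W" and z': "z' \<in> V" and eq: "M x + z = M x' + z'"
    by blast
  have "M (x' - x) = z - z'"
    using eq by (simp add: lin algebra_simps)
  then have "M (x' - x) \<in> range M \<inter> V"
    using V z z' complex_vector.subspace_diff by fastforce
  then have "x' - x \<in> W \<inter> {h. M h = 0}"
    using dV W x x' complex_vector.subspace_diff by fastforce
  then show "x' = x"
    using dW by simp
qed

context
  fixes M :: "'a::complex_hilbert \<Rightarrow> 'b::complex_hilbert" and W V
  assumes M: "bounded_clinear M"
    and W: "closed_csubspace W" and V: "closed_csubspace V"
    and dW: "direct_sum_UNIV W {h. M h = 0}" and dV: "direct_sum_UNIV (range M) V"
begin

interpretation M: bounded_linear M
  using M by (simp add: bounded_clinear_def)

lemma oblique_pinv_eqI: "x \<in> W \<Longrightarrow> z \<in> V \<Longrightarrow> oblique_pinv M W V (M x + z) = x"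
  using W V dW dV
  by (intro oblique_pinv_unique M.diff) (simp_all add: closed_csubspace_def direct_sum_UNIV_def)

text \<open>Existence: split \<open>y\<close> along \<open>range M\<close> and \<open>V\<close>,
  then replace the preimage by its component in \<open>W\<close>, which changes it only by a kernel
  element.\<close>

lemma oblique_pinv_decomp:
  obtains z where "oblique_pinv M W V y \<in> W" "z \<in> V" "y = M (oblique_pinv M W V y) + z"
proof -
  have "y \<in> range M + V"
    using dV by (simp add: direct_sum_UNIV_def)
  then obtain x z where z: "z \<in> V" and y: "y = M x + z"
    by (auto elim!: set_plus_elim)
  have "x \<in> W + {h. M h = 0}"
    using dW by (simp add: direct_sum_UNIV_def)
  then obtain w k where w: "w \<in> W" and k: "M k = 0" and x: "x = w + k"
    by (auto elim!: set_plus_elim)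
  have "y = M w + z"
    by (simp add: y x M.add k)
  then show thesis
    using that w z oblique_pinv_eqI by metis
qed

lemma oblique_pinv_in: "oblique_pinv M W V y \<in> W"
  using oblique_pinv_decomp by metis

lemma diff_oblique_pinv_in: "y - M (oblique_pinv M W V y) \<in> V"
  using oblique_pinv_decomp by (metis add_diff_cancel_left')

lemma oblique_pinv_zero: "v \<in> V \<Longrightarrow> oblique_pinv M W V v = 0"
  using oblique_pinv_eqI[of 0 v] W
  by (simp add: M.zero closed_csubspace_def complex_vector.subspace_0)

lemma oblique_pinv_image: "x \<in> W \<Longrightarrow> oblique_pinv M W V (M x) = x"
  using oblique_pinv_eqI[of x 0] V by (simp add: closed_csubspace_def complex_vector.subspace_0)

text \<open>The criterion \<open>eqI\<close> characterises values by membership in \<open>W\<close>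
  and \<open>V\<close>. Linearity thus follows from the subspace properties, and closedness of the
  graph from closedness of both subspaces and continuity of \<open>M\<close>.\<close>

lemma bounded_clinear_oblique_pinv: "bounded_clinear (oblique_pinv M W V)"
proof -
  let ?N = "oblique_pinv M W V"
  have sW: "csubspace W" and sV: "csubspace V" and cW: "closed W" and cV: "closed V"
    using W V by (simp_all add: closed_csubspace_def)
  have eqI: "x \<in> W \<Longrightarrow> y - M x \<in> V \<Longrightarrow> ?N y = x" for x y
    using oblique_pinv_eqI[of x "y - M x"] by simp
  have scaleC: "?N (a *\<^sub>C y) = a *\<^sub>C ?N y" for a y
  proof (rule eqI)
    show "a *\<^sub>C ?N y \<in> W"
      using sW oblique_pinv_in by (rule complex_vector.subspace_scale)
    have "a *\<^sub>C y - M (a *\<^sub>C ?N y) = a *\<^sub>C (y - M (?N y))"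
      using M by (simp add: bounded_clinear_def complex_vector.scale_right_diff_distrib)
    then show "a *\<^sub>C y - M (a *\<^sub>C ?N y) \<in> V"
      using sV diff_oblique_pinv_in complex_vector.subspace_scale by metis
  qed
  have add: "?N (x + y) = ?N x + ?N y" for x y
  proof (rule eqI)
    show "?N x + ?N y \<in> W"
      using sW oblique_pinv_in oblique_pinv_in by (rule complex_vector.subspace_add)
    have "x + y - M (?N x + ?N y) = (x - M (?N x)) + (y - M (?N y))"
      by (simp add: M.add)
    then show "x + y - M (?N x + ?N y) \<in> V"
      using sV diff_oblique_pinv_in complex_vector.subspace_add by metis
  qed
  have "bounded_linear ?N"
  proof (rule closed_graph)
    show "linear ?N"
      by (rule linearI) (simp_all add: add scaleR_scaleC scaleC)
  next
    fix X x y assume X: "X \<longlonglongrightarrow> x" and N: "(\<lambda>n. ?N (X n)) \<longlonglongrightarrow> y"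
    show "?N x = y"
    proof (rule eqI)
      show "y \<in> W"
        using closed_sequentially[OF cW _ N] oblique_pinv_in by blast
      have "(\<lambda>n. X n - M (?N (X n))) \<longlonglongrightarrow> x - M y"
        by (intro tendsto_diff X M.tendsto N)
      then show "x - M y \<in> V"
        by (rule closed_sequentially[OF cV diff_oblique_pinv_in])
    qed
  qed
  then show ?thesis
    by (simp add: bounded_clinear_def scaleC)
qed

end

theorem theorem5p2:
  fixes \<Psi> :: "nat \<Rightarrow> 'a::complex_hilbert"
    and \<Phi> :: "nat \<Rightarrow> 'b::complex_hilbert"
    and m :: "nat \<Rightarrow> complex"
    and M :: "'a \<Rightarrow> 'b"
    and W :: "'a set"
    and V :: "'b set"
  assumes "separable_space (euclidean :: 'a topology)"
    and "separable_space (euclidean :: 'b topology)"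
    and "bessel_sequence_in UNIV \<Psi>"
    and "bessel_sequence_in UNIV \<Phi>"
    and "bounded (range m)"
    and "M = multiplier m \<Phi> \<Psi>"
    and "closed (range M)"
    and "closed_csubspace W"
    and "closed_csubspace V"
    and "direct_sum_UNIV W {h. M h = 0}"
    and "direct_sum_UNIV (range M) V"
  shows "frame_for W (\<lambda>n. oblique_pinv M W V (m n *\<^sub>C \<Phi> n)) \<and>
         frame_for (orth_compl V) (\<lambda>n. cadjoint (oblique_pinv M W V) (cnj (m n) *\<^sub>C \<Psi> n))"
proof -
  define N where "N = oblique_pinv M W V"
  have M: "bounded_clinear M"
    unfolding assms(6) using assms(3-5) by (rule bounded_clinear_multiplier)
  note pinv = M assms(8-11)
  have M_sums: "(\<lambda>n. (m n * cinner h (\<Psi> n)) *\<^sub>C \<Phi> n) sums M h" for h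
    unfolding assms(6) using assms(3-5) by (rule multiplier_sums)
  have N: "bounded_clinear N"
    unfolding N_def by (rule bounded_clinear_oblique_pinv[OF pinv])
  then have blN: "bounded_linear N" and N_scale: "\<And>a x. N (a *\<^sub>C x) = a *\<^sub>C N x"
    by (simp_all add: bounded_clinear_def)
  note adj = cinner_cadjoint[OF N]
  have adj': "cinner (cadjoint N x) y = cinner x (N y)" for x y
    by (metis adj cinner_commute)
  obtain K where K: "\<And>n. cmod (m n) \<le> K"
    using assms(5) by (auto simp: bounded_iff)
  obtain B1 where B1: "0 < B1" "\<And>h. summable (\<lambda>n. (cmod (cinner h (\<Psi> n)))\<^sup>2)"
      "\<And>h. (\<Sum>n. (cmod (cinner h (\<Psi> n)))\<^sup>2) \<le> B1 * (norm h)\<^sup>2"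
    using bessel_sequence_UNIV_obtain[OF assms(3)] by blast
  obtain B2 where B2: "0 < B2" "\<And>h. summable (\<lambda>n. (cmod (cinner h (\<Phi> n)))\<^sup>2)"
      "\<And>h. (\<Sum>n. (cmod (cinner h (\<Phi> n)))\<^sup>2) \<le> B2 * (norm h)\<^sup>2"
    using bessel_sequence_UNIV_obtain[OF assms(4)] by blast
  have "frame_for W (\<lambda>n. N (m n *\<^sub>C \<Phi> n))"
  proof (rule frame_for_dual_coefficients[OF _ B1(1)])
    show "bessel_sequence_in W (\<lambda>n. N (m n *\<^sub>C \<Phi> n))"
    proof (rule bessel_sequence_in_dominated[OF assms(8) _ assms(4) bounded_linear_cadjoint[OF N]])
      show "range (\<lambda>n. N (m n *\<^sub>C \<Phi> n)) \<subseteq> W"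
        unfolding N_def using oblique_pinv_in[OF pinv] by blast
      \<comment> \<open>Here the dominating operator is the adjoint of \<open>N\<close>; the scalar
        \<open>m n\<close> contributes at most \<open>K\<close>.\<close>
      show "cmod (cinner h (N (m n *\<^sub>C \<Phi> n))) \<le> K * cmod (cinner (cadjoint N h) (\<Phi> n))" for h n
        using K[of n] by (simp add: adj' N_scale cinner_scaleC_right norm_mult mult_right_mono)
    qed
  next
    fix h assume h: "h \<in> W"
    then have "N (M h) = h"
      unfolding N_def by (rule oblique_pinv_image[OF pinv])
    \<comment> \<open>The series for \<open>M h\<close> is mapped termwise through \<open>N\<close>
      and then paired with \<open>h\<close>.\<close>
    moreover have "(\<lambda>n. cinner (N ((m n * cinner h (\<Psi> n)) *\<^sub>C \<Phi> n)) h) sums cinner (N (M h)) h"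
      by (intro bounded_linear.sums[OF bounded_linear_cinner_left] bounded_linear.sums[OF blN] M_sums)
    ultimately show "(\<lambda>n. cinner h (\<Psi> n) * cinner (N (m n *\<^sub>C \<Phi> n)) h) sums complex_of_real ((norm h)\<^sup>2)"
      by (simp add: N_scale cinner_scaleC_left cinner_self mult_ac)
  qed (rule B1)+
  moreover have "frame_for (orth_compl V) (\<lambda>n. cadjoint N (cnj (m n) *\<^sub>C \<Psi> n))"
  proof (rule frame_for_dual_coefficients[OF _ B2(1)])
    show "bessel_sequence_in (orth_compl V) (\<lambda>n. cadjoint N (cnj (m n) *\<^sub>C \<Psi> n))"
    proof (rule bessel_sequence_in_dominated[OF closed_csubspace_orth_compl _ assms(3) blN])
      \<comment> \<open>Vanishing of \<open>N\<close> on \<open>V\<close> puts the range of its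
        adjoint into \<open>orth_compl V\<close>.\<close>
      have "N v = 0" if "v \<in> V" for v
        unfolding N_def using oblique_pinv_zero[OF pinv] that .
      then show "range (\<lambda>n. cadjoint N (cnj (m n) *\<^sub>C \<Psi> n)) \<subseteq> orth_compl V"
        by (auto simp: orth_compl_def adj')
      show "cmod (cinner h (cadjoint N (cnj (m n) *\<^sub>C \<Psi> n))) \<le> K * cmod (cinner (N h) (\<Psi> n))" for h n
        using K[of n] by (simp add: adj[symmetric] cinner_scaleC_right norm_mult mult_right_mono)
    qed
  next
    fix h assume "h \<in> orth_compl V"
    moreover have "h - M (N h) \<in> V"
      unfolding N_def by (rule diff_oblique_pinv_in[OF pinv])
    ultimately have "cinner h (h - M (N h)) = 0"
      by (simp add: orth_compl_def)
    then have "cinner h (M (N h)) = complex_of_real ((norm h)\<^sup>2)"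
      by (simp add: cinner_diff_right cinner_self)
    then have "cinner (M (N h)) h = complex_of_real ((norm h)\<^sup>2)"
      by (metis cinner_commute complex_cnj_complex_of_real)
    moreover have "(\<lambda>n. cinner ((m n * cinner (N h) (\<Psi> n)) *\<^sub>C \<Phi> n) h) sums cinner (M (N h)) h"
      by (intro bounded_linear.sums[OF bounded_linear_cinner_left] M_sums)
    ultimately have "(\<lambda>n. m n * cinner (N h) (\<Psi> n) * cinner (\<Phi> n) h) sums complex_of_real ((norm h)\<^sup>2)"
      by (simp add: cinner_scaleC_left)
    \<comment> \<open>Conjugation turns \<open>cinner (\<Phi> n) h\<close> into the coefficient
      \<open>cinner h (\<Phi> n)\<close> and \<open>m n\<close> into \<open>cnj (m n)\<close>; the
      limit is real and stays fixed.\<close>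
    then have "(\<lambda>n. cnj (m n * cinner (N h) (\<Psi> n) * cinner (\<Phi> n) h)) sums cnj (complex_of_real ((norm h)\<^sup>2))"
      by (simp only: sums_cnj)
    moreover have "cnj (m n * cinner (N h) (\<Psi> n) * cinner (\<Phi> n) h)
        = cinner h (\<Phi> n) * cinner (cadjoint N (cnj (m n) *\<^sub>C \<Psi> n)) h" for n
      by (simp add: adj' cinner_scaleC_left cinner_commute[of h "\<Phi> n"] cinner_commute[of "\<Psi> n" "N h"])
    ultimately show "(\<lambda>n. cinner h (\<Phi> n) * cinner (cadjoint N (cnj (m n) *\<^sub>C \<Psi> n)) h)
        sums complex_of_real ((norm h)\<^sup>2)"
      by simp
  qed (rule B2)+
  ultimately show ?thesis
    by (simp add: N_def)
qed

end
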